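(* Let $\chi$ be a functional random variable in $L^{2}(T)$ with mean function $\mu_{\chi}$ and compact covariance operator $\Gamma_{\chi}$, and let $K$ be a positive integer with $\lambda_K>0$. The functional Mahalanobis semi-distance between $\chi$ and $\mu_{\chi}$ can be written as $$d_{FM}^{K}(\chi,\mu_{\chi})=\left(\sum_{k=1}^{K}\omega_{k}^{2}\right)^{1/2},$$ where $\omega_{k}=\theta_{k}/\lambda_{k}^{1/2}$, for $k=1,\ldots,K$, are the standardized functional principal component scores of $\chi$.
   Context: $T=[a,b]$ is a closed interval of the real line and $L^{2}(T)$ is the real Hilbert space of square integrable functions on $T$, with inner product $\langle f,g\rangle=\int_T f(t)g(t)\,dt$ and norm $\|\cdot\|_2$. A functional random variable $\chi$ is a random element of $L^2(T)$; it is assumed throughout that $E[\|\chi\|_2^4]<\infty$. Its mean function is $\mu_\chi(t)=E[\chi(t)]$ and its covariance operator is $\Gamma_\chi(\eta)=E[\langle \chi-\mu_\chi,\eta\rangle(\chi-\mu_\chi)]$ for $\eta\in L^2(T)$, which is compact. Let $\lambda_1\ge\lambda_2\ge\cdots\ge 0$ be the eigenvalues of $\Gamma_\chi$ ($\sum_k\lambda_k<\infty$), and let $\psi_1,\psi_2,\ldots$ be a fixed associated sequence of orthonormal eigenfunctions, $\Gamma_\chi(\psi_k)=\lambda_k\psi_k$, forming an orthonormal basis of $L^2(T)$. The functional principal component scores of $\chi$ are $\theta_k=\langle\chi-\mu_\chi,\psi_k\rangle$, $k=1,2,\ldots$, so that $\chi=\mu_\chi+\sum_{k=1}^\infty\theta_k\psi_k$.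 For functions $f,g$, $(f\otimes f)(g)=\langle f,g\rangle f$. For a positive integer $K$ with $\lambda_K>0$, the regularized square root inverse operator is $$\Gamma_K^{-1/2}(\zeta)=\sum_{k=1}^K\frac{1}{\lambda_k^{1/2}}(\psi_k\otimes\psi_k)(\zeta)=\sum_{k=1}^K\frac{\langle\psi_k,\zeta\rangle}{\lambda_k^{1/2}}\psi_k .$$ The functional Mahalanobis semi-distance between $\chi$ and $\mu_\chi$ is $$d_{FM}^K(\chi,\mu_\chi)=\left\langle\Gamma_K^{-1/2}(\chi-\mu_\chi),\Gamma_K^{-1/2}(\chi-\mu_\chi)\right\rangle^{1/2}.$$ *)

theory Defs
  imports "HOL-Probability.Probability"
begin

text \<open>
  Elements of $L^2(T)$ are represented by square integrable functions, and equality in $L^2(T)$ is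
  equality almost everywhere with respect to Lebesgue measure on \<open>T\<close>.
\<close>

definition L2 :: "real set \<Rightarrow> (real \<Rightarrow> real) set" where
  "L2 T = {f \<in> borel_measurable (lebesgue_on T). integrable (lebesgue_on T) (\<lambda>t. (f t)\<^sup>2)}"

definition L2_inner :: "real set \<Rightarrow> (real \<Rightarrow> real) \<Rightarrow> (real \<Rightarrow> real) \<Rightarrow> real" where
  "L2_inner T f g = (LINT t|lebesgue_on T. f t * g t)"

definition L2_norm :: "real set \<Rightarrow> (real \<Rightarrow> real) \<Rightarrow> real" where
  "L2_norm T f = sqrt (L2_inner T f f)"

text \<open>
  A random element of $L^2(T)$ is given by a jointly measurable version with paths in $L^2(T)$.
  Every Borel random element of the separable space $L^2(T)$ has such a version, and joint
  measurability is what gives the pointwise expectations $E[X(t)]$ below a meaning (for almost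
  every \<open>t\<close>). The fourth moment condition is part of the notion.
\<close>

definition functional_random_variable ::
    "'w measure \<Rightarrow> real set \<Rightarrow> ('w \<Rightarrow> real \<Rightarrow> real) \<Rightarrow> bool" where
  "functional_random_variable M T X \<longleftrightarrow>
     prob_space M \<and>
     (\<lambda>(w, t). X w t) \<in> borel_measurable (M \<Otimes>\<^sub>M lebesgue_on T) \<and>
     (\<forall>w\<in>space M. X w \<in> L2 T) \<and>
     integrable M (\<lambda>w. L2_norm T (X w) ^ 4)"

definition mean_fun :: "'w measure \<Rightarrow> ('w \<Rightarrow> real \<Rightarrow> real) \<Rightarrow> real \<Rightarrow> real" where
  "mean_fun M X t = (LINT w|M. X w t)"

definition centred :: "'w measure \<Rightarrow> ('w \<Rightarrow> real \<Rightarrow> real) \<Rightarrow> 'w \<Rightarrow> real \<Rightarrow> real" where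
  "centred M X w = (\<lambda>t. X w t - mean_fun M X t)"

definition cov_op ::
    "'w measure \<Rightarrow> real set \<Rightarrow> ('w \<Rightarrow> real \<Rightarrow> real) \<Rightarrow> (real \<Rightarrow> real) \<Rightarrow> real \<Rightarrow> real" where
  "cov_op M T X \<eta> t = (LINT w|M. L2_inner T (centred M X w) \<eta> * centred M X w t)"

text \<open>
  Sequential form of compactness: bounded sequences are mapped to sequences with a subsequence
  converging in $L^2(T)$. Linearity is not part of this predicate.
\<close>

definition L2_compact_op :: "real set \<Rightarrow> ((real \<Rightarrow> real) \<Rightarrow> real \<Rightarrow> real) \<Rightarrow> bool" where
  "L2_compact_op T A \<longleftrightarrow>
     (\<forall>f\<in>L2 T. A f \<in> L2 T) \<and>
     (\<forall>f C. (\<forall>n::nat. f n \<in> L2 T \<and> L2_norm T (f n) \<le> C) \<longrightarrow>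
        (\<exists>g\<in>L2 T. \<exists>r. strict_mono r \<and>
           (\<lambda>n. L2_norm T (\<lambda>t. A (f (r n)) t - g t)) \<longlonglongrightarrow> 0))"

text \<open>Sequences are indexed from 1; their values at index 0 are irrelevant.\<close>

definition L2_orthonormal_basis :: "real set \<Rightarrow> (nat \<Rightarrow> real \<Rightarrow> real) \<Rightarrow> bool" where
  "L2_orthonormal_basis T \<psi> \<longleftrightarrow>
     (\<forall>k\<ge>1. \<psi> k \<in> L2 T) \<and>
     (\<forall>j\<ge>1. \<forall>k\<ge>1. L2_inner T (\<psi> j) (\<psi> k) = (if j = k then 1 else 0)) \<and>
     (\<forall>f\<in>L2 T.
        (\<lambda>n. L2_norm T (\<lambda>t. f t - (\<Sum>k=1..n. L2_inner T f (\<psi> k) * \<psi> k t))) \<longlonglongrightarrow> 0)"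

text \<open>
  Since the eigenfunctions form an orthonormal basis, \<open>l\<close> lists all eigenvalues of \<open>A\<close>, repeated
  according to multiplicity.
\<close>

definition L2_eigensystem ::
    "real set \<Rightarrow> ((real \<Rightarrow> real) \<Rightarrow> real \<Rightarrow> real) \<Rightarrow> (nat \<Rightarrow> real) \<Rightarrow> (nat \<Rightarrow> real \<Rightarrow> real) \<Rightarrow> bool" where
  "L2_eigensystem T A l \<psi> \<longleftrightarrow>
     L2_orthonormal_basis T \<psi> \<and>
     (\<forall>k\<ge>1. AE t in lebesgue_on T. A (\<psi> k) t = l k * \<psi> k t) \<and>
     (\<forall>k\<ge>1. 0 \<le> l k \<and> l (Suc k) \<le> l k) \<and>
     summable (\<lambda>k. l (Suc k))"

definition fpc_score ::
    "'w measure \<Rightarrow> real set \<Rightarrow> ('w \<Rightarrow> real \<Rightarrow> real) \<Rightarrow> (nat \<Rightarrow> real \<Rightarrow> real) \<Rightarrow> nat \<Rightarrow> 'w \<Rightarrow> real" where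
  "fpc_score M T X \<psi> k w = L2_inner T (centred M X w) (\<psi> k)"

definition std_fpc_score ::
    "'w measure \<Rightarrow> real set \<Rightarrow> ('w \<Rightarrow> real \<Rightarrow> real) \<Rightarrow> (nat \<Rightarrow> real) \<Rightarrow> (nat \<Rightarrow> real \<Rightarrow> real) \<Rightarrow>
     nat \<Rightarrow> 'w \<Rightarrow> real" where
  "std_fpc_score M T X l \<psi> k w = fpc_score M T X \<psi> k w / sqrt (l k)"

definition L2_tensor_square :: "real set \<Rightarrow> (real \<Rightarrow> real) \<Rightarrow> (real \<Rightarrow> real) \<Rightarrow> real \<Rightarrow> real" where
  "L2_tensor_square T f g = (\<lambda>t. L2_inner T f g * f t)"

definition reg_inv_sqrt ::
    "real set \<Rightarrow> (nat \<Rightarrow> real) \<Rightarrow> (nat \<Rightarrow> real \<Rightarrow> real) \<Rightarrow> nat \<Rightarrow> (real \<Rightarrow> real) \<Rightarrow> real \<Rightarrow> real" where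
  "reg_inv_sqrt T l \<psi> K \<zeta> = (\<lambda>t. \<Sum>k=1..K. 1 / sqrt (l k) * L2_tensor_square T (\<psi> k) \<zeta> t)"

definition fm_semidist ::
    "real set \<Rightarrow> (nat \<Rightarrow> real) \<Rightarrow> (nat \<Rightarrow> real \<Rightarrow> real) \<Rightarrow> nat \<Rightarrow>
     (real \<Rightarrow> real) \<Rightarrow> (real \<Rightarrow> real) \<Rightarrow> real" where
  "fm_semidist T l \<psi> K f g =
     sqrt (L2_inner T (reg_inv_sqrt T l \<psi> K (\<lambda>t. f t - g t)) (reg_inv_sqrt T l \<psi> K (\<lambda>t. f t - g t)))"

end

theory Submission imports Defs begin

text \<open>
  The image of \<open>\<chi> - \<mu>\<close> under the regularized square root inverse is the finite linear combination
  of the orthonormal functions \<open>\<psi> 1, \<dots>, \<psi> K\<close> whose coefficients are exactly the standardized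
  scores \<open>\<theta> k / sqrt (l k)\<close>. Pythagoras (\<open>L2_inner_orthonormal_sum\<close>) turns its squared norm into
  the sum of the squared coefficients. The argument is pathwise: it holds for each outcome
  separately. The analytic content is confined to the integrability of products of square
  integrable functions (\<open>L2_mult_integrable\<close>), without which the inner product would not be
  additive, the integral of a nonintegrable function being 0 by convention.
\<close>

text \<open>
  The qualitative part of the Cauchy-Schwarz inequality: by \<open>2 * \<bar>x * y\<bar> \<le> x\<^sup>2 + y\<^sup>2\<close> the product
  is dominated by an integrable function.
\<close>

lemma L2_mult_integrable:
  assumes "f \<in> L2 T" and "g \<in> L2 T"
  shows "integrable (lebesgue_on T) (\<lambda>t. f t * g t)"
proof (rule Bochner_Integration.integrable_bound)
  show "integrable (lebesgue_on T) (\<lambda>t. (f t)\<^sup>2 + (g t)\<^sup>2)"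
    using assms by (simp add: L2_def)
  show "(\<lambda>t. f t * g t) \<in> borel_measurable (lebesgue_on T)"
    using assms by (intro borel_measurable_times) (auto simp: L2_def)
  have "\<bar>x * y\<bar> \<le> x\<^sup>2 + y\<^sup>2" for x y :: real
  proof -
    have "2 * \<bar>x * y\<bar> \<le> x\<^sup>2 + y\<^sup>2"
      using sum_squares_bound[of "\<bar>x\<bar>" "\<bar>y\<bar>"] by (simp add: abs_mult)
    then show ?thesis by linarith
  qed
  then show "AE t in lebesgue_on T. norm (f t * g t) \<le> norm ((f t)\<^sup>2 + (g t)\<^sup>2)"
    by simp
qed

lemma L2_inner_commute: "L2_inner T f g = L2_inner T g f"
  by (simp add: L2_inner_def mult.commute)

lemma L2_inner_sum_sum:
  assumes "\<And>i. i \<in> I \<Longrightarrow> e i \<in> L2 T" and "\<And>j. j \<in> J \<Longrightarrow> h j \<in> L2 T"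
  shows "L2_inner T (\<lambda>t. \<Sum>i\<in>I. c i * e i t) (\<lambda>t. \<Sum>j\<in>J. d j * h j t)
       = (\<Sum>i\<in>I. \<Sum>j\<in>J. c i * d j * L2_inner T (e i) (h j))"
proof -
  have int: "integrable (lebesgue_on T) (\<lambda>t. c i * d j * (e i t * h j t))"
    if "i \<in> I" "j \<in> J" for i j
    using L2_mult_integrable[OF assms(1)[OF that(1)] assms(2)[OF that(2)]] by simp
  have "L2_inner T (\<lambda>t. \<Sum>i\<in>I. c i * e i t) (\<lambda>t. \<Sum>j\<in>J. d j * h j t)
      = (LINT t|lebesgue_on T. (\<Sum>i\<in>I. \<Sum>j\<in>J. c i * d j * (e i t * h j t)))"
    by (simp add: L2_inner_def sum_product mult_ac)
  also have "\<dots> = (\<Sum>i\<in>I. (LINT t|lebesgue_on T. (\<Sum>j\<in>J. c i * d j * (e i t * h j t))))"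
    by (intro Bochner_Integration.integral_sum Bochner_Integration.integrable_sum int)
  also have "\<dots> = (\<Sum>i\<in>I. \<Sum>j\<in>J. (LINT t|lebesgue_on T. c i * d j * (e i t * h j t)))"
    by (intro sum.cong refl Bochner_Integration.integral_sum int)
  finally show ?thesis by (simp add: L2_inner_def)
qed

lemma L2_inner_orthonormal_sum:
  assumes "finite I" and "\<And>i. i \<in> I \<Longrightarrow> e i \<in> L2 T"
    and "\<And>i j. i \<in> I \<Longrightarrow> j \<in> I \<Longrightarrow> L2_inner T (e i) (e j) = (if i = j then 1 else 0)"
  shows "L2_inner T (\<lambda>t. \<Sum>i\<in>I. c i * e i t) (\<lambda>t. \<Sum>i\<in>I. c i * e i t) = (\<Sum>i\<in>I. (c i)\<^sup>2)"
proof -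
  have "L2_inner T (\<lambda>t. \<Sum>i\<in>I. c i * e i t) (\<lambda>t. \<Sum>i\<in>I. c i * e i t)
      = (\<Sum>i\<in>I. \<Sum>j\<in>I. c i * c j * L2_inner T (e i) (e j))"
    using assms(2) assms(2) by (rule L2_inner_sum_sum)
  also have "\<dots> = (\<Sum>i\<in>I. \<Sum>j\<in>I. if i = j then c i * c j else 0)"
    by (intro sum.cong refl) (simp add: assms(3))
  also have "\<dots> = (\<Sum>i\<in>I. (c i)\<^sup>2)"
    using assms(1) by (simp add: sum.delta power2_eq_square)
  finally show ?thesis .
qed

lemma reg_inv_sqrt_centred:
  "reg_inv_sqrt T l \<psi> K (centred M X w) = (\<lambda>t. \<Sum>k=1..K. std_fpc_score M T X l \<psi> k w * \<psi> k t)"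
  by (simp add: reg_inv_sqrt_def L2_tensor_square_def std_fpc_score_def fpc_score_def
      L2_inner_commute[of T "\<psi> _"])

theorem proposition2p1:
  fixes M :: "'w measure" and a b :: real and X :: "'w \<Rightarrow> real \<Rightarrow> real"
    and l :: "nat \<Rightarrow> real" and \<psi> :: "nat \<Rightarrow> real \<Rightarrow> real" and K :: nat
  assumes "a < b"
    and "functional_random_variable M {a..b} X"
    and "L2_compact_op {a..b} (cov_op M {a..b} X)"
    and "L2_eigensystem {a..b} (cov_op M {a..b} X) l \<psi>"
    and "K \<ge> 1" and "l K > 0"
  shows "\<forall>w\<in>space M. fm_semidist {a..b} l \<psi> K (X w) (mean_fun M X)
           = sqrt (\<Sum>k=1..K. (std_fpc_score M {a..b} X l \<psi> k w)\<^sup>2)"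
proof
  fix w
  let ?T = "{a..b}"
  let ?R = "reg_inv_sqrt ?T l \<psi> K (centred M X w)"
  have basis: "L2_orthonormal_basis ?T \<psi>"
    using assms(4) by (simp add: L2_eigensystem_def)
  have "L2_inner ?T ?R ?R = (\<Sum>k=1..K. (std_fpc_score M ?T X l \<psi> k w)\<^sup>2)"
    unfolding reg_inv_sqrt_centred
    using basis by (intro L2_inner_orthonormal_sum) (auto simp: L2_orthonormal_basis_def)
  then show "fm_semidist ?T l \<psi> K (X w) (mean_fun M X)
      = sqrt (\<Sum>k=1..K. (std_fpc_score M ?T X l \<psi> k w)\<^sup>2)"
    by (simp add: fm_semidist_def centred_def)
qed

end
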